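(* With the functions $G_{j,k}$ defined in the context, it holds that $$\widehat{G_{3,1}}(\pm1)=\widehat{G_{1,2}}(\pm1)=0 .$$
   Context: Fourier transform: $\widehat f(\xi)=\frac{1}{\sqrt{2\pi}}\int_{\mathbb{R}}e^{-ix\xi}f(x)\,dx$. Let $Q(x)=\sqrt2\,\mathrm{sech}(x)$, $\Psi_1(x)=\tanh^2(x)$, $\Psi_2(x)=-\mathrm{sech}^2(x)$, $\vec\Psi=(\Psi_1,\Psi_2)^\top$, and $$\mathcal{Q}_1(\vec\Psi)=\begin{bmatrix}-Q\Psi_2^2-2Q\Psi_1\Psi_2\\ Q\Psi_1^2+2Q\Psi_1\Psi_2\end{bmatrix},\quad \mathcal{Q}_2(\vec\Psi)=\begin{bmatrix}-2Q\Psi_1\Psi_2-2Q(\Psi_1^2+\Psi_2^2)\\ 2Q\Psi_1\Psi_2+2Q(\Psi_1^2+\Psi_2^2)\end{bmatrix},\quad \mathcal{Q}_3(\vec\Psi)=\begin{bmatrix}-Q\Psi_1^2-2Q\Psi_1\Psi_2\\ Q\Psi_2^2+2Q\Psi_1\Psi_2\end{bmatrix}.$$ Let $S=\partial_x+\tanh(x)$ (a first-order differential operator), $L_+=-\partial_x^2-6\,\mathrm{sech}^2(x)+1$, and $$\mathcal{D}=\begin{bmatrix}0&(-\partial_x^2+1)S^2\\-S^2L_+&0\end{bmatrix},\qquad \mathcal{J}=\frac{1}{\sqrt2}\begin{bmatrix}1&i\\1&-i\end{bmatrix},\qquad \widetilde{\mathcal{D}}=\mathcal{J}\mathcal{D}\mathcal{J}^{-1}.$$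 The functions $G_{j,1},G_{j,2}$ are defined by $(G_{j,1},G_{j,2})^\top:=\widetilde{\mathcal{D}}\,\mathcal{Q}_j(\vec\Psi)$ for $1\le j\le3$. *)

theory Defs
  imports "HOL-Analysis.Analysis"
begin

definition sech :: "real \<Rightarrow> real" where
  "sech x = 1 / cosh x"

text \<open>For an integrable \<open>f\<close>; the Bochner integral is 0 by convention if \<open>f\<close> is not integrable.\<close>

definition fourier :: "(real \<Rightarrow> complex) \<Rightarrow> real \<Rightarrow> complex" where
  "fourier f \<xi> = complex_of_real (1 / sqrt (2 * pi)) *
     (LINT x|lborel. exp (- (\<i> * complex_of_real x * complex_of_real \<xi>)) * f x)"

text \<open>Scalar differential operators, acting on complex-valued functions of a real variable.\<close>

definition dx :: "(real \<Rightarrow> complex) \<Rightarrow> real \<Rightarrow> complex" where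
  "dx f = (\<lambda>x. vector_derivative f (at x))"

definition S_op :: "(real \<Rightarrow> complex) \<Rightarrow> real \<Rightarrow> complex" where
  "S_op f = (\<lambda>x. dx f x + complex_of_real (tanh x) * f x)"

definition L_plus :: "(real \<Rightarrow> complex) \<Rightarrow> real \<Rightarrow> complex" where
  "L_plus f = (\<lambda>x. - dx (dx f) x - 6 * complex_of_real (sech x ^ 2) * f x + f x)"

definition one_minus_dxx :: "(real \<Rightarrow> complex) \<Rightarrow> real \<Rightarrow> complex" where
  "one_minus_dxx f = (\<lambda>x. - dx (dx f) x + f x)"

text \<open>Matrix operators, acting on functions with values in \<open>complex ^ 2\<close>.\<close>

definition D_op :: "(real \<Rightarrow> complex ^ 2) \<Rightarrow> real \<Rightarrow> complex ^ 2" where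
  "D_op F = (\<lambda>x. vector
     [one_minus_dxx (S_op (S_op (\<lambda>y. F y $ 2))) x,
      - S_op (S_op (L_plus (\<lambda>y. F y $ 1))) x])"

definition J_mat :: "complex ^ 2 ^ 2" where
  "J_mat = (1 / sqrt 2) *\<^sub>R vector [vector [1, \<i>], vector [1, - \<i>]]"

definition D_tilde :: "(real \<Rightarrow> complex ^ 2) \<Rightarrow> real \<Rightarrow> complex ^ 2" where
  "D_tilde F = (\<lambda>x. J_mat *v D_op (\<lambda>y. matrix_inv J_mat *v F y) x)"

definition Q :: "real \<Rightarrow> complex" where
  "Q x = complex_of_real (sqrt 2 * sech x)"

definition Psi :: "real \<Rightarrow> complex ^ 2" where
  "Psi x = vector [complex_of_real (tanh x ^ 2), complex_of_real (- (sech x ^ 2))]"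

definition quad1 :: "(real \<Rightarrow> complex ^ 2) \<Rightarrow> real \<Rightarrow> complex ^ 2" where
  "quad1 P = (\<lambda>x. let p = P x $ 1; q = P x $ 2 in vector
     [- (Q x * q ^ 2) - 2 * Q x * p * q,
      Q x * p ^ 2 + 2 * Q x * p * q])"

definition quad2 :: "(real \<Rightarrow> complex ^ 2) \<Rightarrow> real \<Rightarrow> complex ^ 2" where
  "quad2 P = (\<lambda>x. let p = P x $ 1; q = P x $ 2 in vector
     [- (2 * Q x * p * q) - 2 * Q x * (p ^ 2 + q ^ 2),
      2 * Q x * p * q + 2 * Q x * (p ^ 2 + q ^ 2)])"

definition quad3 :: "(real \<Rightarrow> complex ^ 2) \<Rightarrow> real \<Rightarrow> complex ^ 2" where
  "quad3 P = (\<lambda>x. let p = P x $ 1; q = P x $ 2 in vector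
     [- (Q x * p ^ 2) - 2 * Q x * p * q,
      Q x * q ^ 2 + 2 * Q x * p * q])"

text \<open>Only the indices 1, 2, 3 are meaningful; other values of \<open>j\<close> give 0.\<close>

definition quad :: "nat \<Rightarrow> (real \<Rightarrow> complex ^ 2) \<Rightarrow> real \<Rightarrow> complex ^ 2" where
  "quad j P = (if j = 1 then quad1 P else if j = 2 then quad2 P
     else if j = 3 then quad3 P else (\<lambda>x. 0))"

definition G :: "nat \<Rightarrow> 2 \<Rightarrow> real \<Rightarrow> complex" where
  "G j k = (\<lambda>x. D_tilde (quad j Psi) x $ k)"

end

theory Submission
  imports Defs "HOL-Computational_Algebra.Polynomial"
begin

text \<open>
  All functions involved are polynomials in \<open>s = sech\<close>: since \<open>s' = - tanh \<cdot> s\<close> and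
  \<open>tanh\<^sup>2 = 1 - s\<^sup>2\<close>, the operators \<open>\<partial>\<^sub>x\<^sup>2\<close> and \<open>S\<^sup>2\<close> preserve this class.
  One finds \<open>G\<^sub>3\<^sub>,\<^sub>1 = G\<^sub>1\<^sub>,\<^sub>2 = -60 \<surd>2 \<i> (-2 s\<^sup>3 + 31 s\<^sup>5 - 83 s\<^sup>7 + 56 s\<^sup>9)\<close>, and the last factor
  is \<open>h'' + h\<close> for \<open>h = - s\<^sup>3/5 + 11 s\<^sup>5/10 - s\<^sup>7\<close>. As \<open>h\<close> decays at infinity, the Fourier
  transform of \<open>h'' + \<xi>\<^sup>2 h\<close> vanishes at \<open>\<xi>\<close>, and \<open>\<xi>\<^sup>2 = 1\<close> for \<open>\<xi> = \<plusminus>1\<close>.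
\<close>

section \<open>The inverse of \<open>J_mat\<close>\<close>

lemma matrix_inv_eqI:
  fixes A :: "'a::semiring_1 ^ 'n ^ 'm"
  assumes "A ** B = mat 1" "B ** A = mat 1"
  shows "matrix_inv A = B"
  unfolding matrix_inv_def
\<comment> \<open>\<open>matrix_inv\<close> is a Hilbert choice among two-sided inverses, so their
  uniqueness pins it down.\<close>
proof (rule some_equality)
  fix C assume "A ** C = mat 1 \<and> C ** A = mat 1"
  then show "C = B"
    by (metis assms(2) matrix_mul_assoc matrix_mul_lid matrix_mul_rid)
qed (use assms in blast)

lemma matrix_inv_J_mat:
  "matrix_inv J_mat = (1 / sqrt 2) *\<^sub>R vector [vector [1, 1], vector [- \<i>, \<i>]]"
  by (rule matrix_inv_eqI)
    (simp_all add: J_mat_def vec_eq_iff forall_2 matrix_matrix_mult_def sum_2 mat_def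
      scaleR_conv_of_real[where ?'a = complex] field_simps flip: of_real_mult)

section \<open>Calculus of \<open>sech\<close> and \<open>tanh\<close>\<close>

lemma tanh_squared_sech: "tanh x ^ 2 = 1 - sech x ^ 2"
  using sinh_square_eq[of x] by (simp add: tanh_def sech_def power_divide diff_divide_distrib)

lemma has_real_derivative_sech [THEN DERIV_chain2, derivative_intros]:
  "(sech has_real_derivative - (tanh x * sech x)) (at x)"
  unfolding sech_def [abs_def] tanh_def
  by (auto intro!: derivative_eq_intros simp: power2_eq_square)

lemma sech_nonneg: "0 \<le> sech x" and sech_le_1: "sech x \<le> 1"
  by (simp_all add: sech_def cosh_real_ge_1)

lemma tendsto_sech_at_top: "(sech \<longlongrightarrow> 0) at_top"
  and tendsto_sech_at_bot: "(sech \<longlongrightarrow> 0) at_bot"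
  unfolding sech_def [abs_def]
  by (rule real_tendsto_divide_at_top[OF tendsto_const] cosh_real_at_top cosh_real_at_bot)+

section \<open>The differential operators on polynomials in \<open>sech\<close>\<close>

lemma has_real_derivative_poly_sech:
  "((\<lambda>x. poly p (sech x)) has_real_derivative
     - (tanh x * sech x * poly (pderiv p) (sech x))) (at x)"
  by (auto intro!: derivative_eq_intros DERIV_chain2[OF poly_DERIV])

declare has_real_derivative_poly_sech [THEN DERIV_chain2, derivative_intros]

text \<open>With s = \<open>sech x\<close>, the chain rule gives p(s)'' = s'^2 p''(s) + s'' p'(s),
  where s'^2 = s^2 - s^4 and s'' = s - 2 s^3.\<close>

definition dxx_poly :: "real poly \<Rightarrow> real poly" where
  "dxx_poly p = [:0, 0, 1, 0, -1:] * pderiv (pderiv p) + [:0, 1, 0, -2:] * pderiv p"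

text \<open>Since tanh' + tanh^2 = 1, S^2 f = f'' + 2 tanh f' + f. For f = p(s) the middle term is
  -2 (s - s^3) p'(s), again a polynomial in s.\<close>

definition SS_poly :: "real poly \<Rightarrow> real poly" where
  "SS_poly p = [:0, 0, 1, 0, -1:] * pderiv (pderiv p) - [:0, 1:] * pderiv p + p"

lemma has_real_derivative_dx_poly_sech:
  "((\<lambda>x. - (tanh x * sech x * poly (pderiv p) (sech x))) has_real_derivative
     poly (dxx_poly p) (sech x)) (at x)"
proof -
  \<comment> \<open>Right-nested products hide the square of \<open>tanh x\<close>; this rule still
    eliminates it there.\<close>
  have t: "tanh x * (tanh x * y) = (1 - sech x ^ 2) * y" for y
    using tanh_squared_sech[of x] by (simp add: power2_eq_square flip: mult.assoc)
  show ?thesis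
    by (auto intro!: derivative_eq_intros
        simp: dxx_poly_def tanh_squared_sech algebra_simps power2_eq_square t)
qed

text \<open>The constant \<open>c\<close> is complex because conjugation by \<open>J_mat\<close>
  brings in the imaginary unit.\<close>

lemma dx_of_real:
  assumes "\<And>x. (g has_real_derivative g' x) (at x)"
  shows "dx (\<lambda>x. c * complex_of_real (g x)) = (\<lambda>x. c * complex_of_real (g' x))"
  unfolding dx_def using assms
  by (intro ext vector_derivative_at has_vector_derivative_mult_right
      has_vector_derivative_of_real)

lemma dx_dx_poly_sech:
  "dx (dx (\<lambda>x. c * complex_of_real (poly p (sech x)))) =
    (\<lambda>x. c * complex_of_real (poly (dxx_poly p) (sech x)))"
  unfolding dx_of_real[OF has_real_derivative_poly_sech]
  by (rule dx_of_real[OF has_real_derivative_dx_poly_sech])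

lemma S_op_of_real:
  assumes "\<And>x. (g has_real_derivative g' x) (at x)"
  shows "S_op (\<lambda>x. c * complex_of_real (g x)) =
    (\<lambda>x. c * complex_of_real (g' x + tanh x * g x))"
  unfolding S_op_def dx_of_real[OF assms] by (simp add: algebra_simps)

lemma S_op_S_op_poly_sech:
  "S_op (S_op (\<lambda>x. c * complex_of_real (poly p (sech x)))) =
    (\<lambda>x. c * complex_of_real (poly (SS_poly p) (sech x)))"
proof -
  let ?g' = "\<lambda>x. - (tanh x * sech x * poly (pderiv p) (sech x))"
  have d: "((\<lambda>x. ?g' x + tanh x * poly p (sech x)) has_real_derivative
      poly (dxx_poly p) (sech x) + ((1 - tanh x ^ 2) * poly p (sech x) + ?g' x * tanh x)) (at x)"
    for x
    by (intro DERIV_add DERIV_mult has_real_derivative_dx_poly_sech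
        has_real_derivative_poly_sech)
      (auto intro!: derivative_eq_intros)
  have t: "tanh x * (tanh x * y) = (1 - sech x ^ 2) * y" for x y
    using tanh_squared_sech[of x] by (simp add: power2_eq_square flip: mult.assoc)
  show ?thesis
    unfolding S_op_of_real[OF has_real_derivative_poly_sech]
      S_op_of_real[OF d]
    by (intro ext arg_cong[of _ _ "\<lambda>r. c * complex_of_real r"])
      (simp add: dxx_poly_def SS_poly_def tanh_squared_sech algebra_simps power2_eq_square t)
qed

lemma one_minus_dxx_poly_sech:
  "one_minus_dxx (\<lambda>x. c * complex_of_real (poly p (sech x))) =
    (\<lambda>x. c * complex_of_real (poly (p - dxx_poly p) (sech x)))"
  unfolding one_minus_dxx_def dx_dx_poly_sech by (simp add: algebra_simps)

lemma L_plus_poly_sech: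
  "L_plus (\<lambda>x. c * complex_of_real (poly p (sech x))) =
    (\<lambda>x. c * complex_of_real (poly (p - dxx_poly p - [:0, 0, 6:] * p) (sech x)))"
  unfolding L_plus_def dx_dx_poly_sech by (simp add: algebra_simps power2_eq_square)

text \<open>Up to constants, the inverse of \<open>J_mat\<close> forms the sum and the difference of
  the components. The sum passes through S^2 \<open>L_plus\<close> and yields \<open>A\<close>; the
  difference passes through \<open>one_minus_dxx\<close> S^2 and yields \<open>B\<close>. Then
  \<open>J_mat\<close> recombines them.\<close>

lemma D_tilde_poly_sech:
  assumes "\<And>x. F x $ 1 + F x $ 2 = complex_of_real (sqrt 2 * poly p (sech x))"
    and "\<And>x. F x $ 1 - F x $ 2 = complex_of_real (sqrt 2 * poly q (sech x))"
  defines "A \<equiv> SS_poly (p - dxx_poly p - [:0, 0, 6:] * p)"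
    and "B \<equiv> SS_poly q - dxx_poly (SS_poly q)"
  shows "D_tilde F x $ 1 = - \<i> / sqrt 2 * complex_of_real (poly (B + A) (sech x))"
    and "D_tilde F x $ 2 = - \<i> / sqrt 2 * complex_of_real (poly (B - A) (sech x))"
proof -
  let ?K = "matrix_inv J_mat"
  have "(?K *v F y) $ 1 = complex_of_real (1 / sqrt 2) * (F y $ 1 + F y $ 2)" for y
    by (simp add: matrix_inv_J_mat matrix_vector_mult_def sum_2
        scaleR_conv_of_real[where ?'a = complex] algebra_simps)
  \<comment> \<open>The factor 1 gives the shape \<open>c * complex_of_real ...\<close> that the
    operator lemmas rewrite.\<close>
  then have 1: "(\<lambda>y. (?K *v F y) $ 1) = (\<lambda>y. 1 * complex_of_real (poly p (sech y)))"
    by (simp add: assms)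
  have "(?K *v F y) $ 2 = - \<i> * complex_of_real (1 / sqrt 2) * (F y $ 1 - F y $ 2)" for y
    by (simp add: matrix_inv_J_mat matrix_vector_mult_def sum_2
        scaleR_conv_of_real[where ?'a = complex] algebra_simps)
  then have 2: "(\<lambda>y. (?K *v F y) $ 2) = (\<lambda>y. - \<i> * complex_of_real (poly q (sech y)))"
    by (simp add: assms)
  have D: "D_op (\<lambda>y. ?K *v F y) x = vector
      [- \<i> * complex_of_real (poly B (sech x)), - complex_of_real (poly A (sech x))]"
    unfolding D_op_def 1 2 A_def B_def
      L_plus_poly_sech S_op_S_op_poly_sech one_minus_dxx_poly_sech by simp
  show "D_tilde F x $ 1 = - \<i> / sqrt 2 * complex_of_real (poly (B + A) (sech x))"
    and "D_tilde F x $ 2 = - \<i> / sqrt 2 * complex_of_real (poly (B - A) (sech x))"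
    unfolding D_tilde_def D
    by (simp_all add: J_mat_def matrix_vector_mult_def sum_2
        scaleR_conv_of_real[where ?'a = complex] algebra_simps diff_divide_distrib add_divide_distrib)
qed

section \<open>Integrability and vanishing Fourier transforms\<close>

lemma continuous_on_sech: "continuous_on UNIV sech"
  by (intro DERIV_continuous_on) (auto intro!: derivative_eq_intros)

lemma borel_measurable_sech [measurable]: "sech \<in> borel_measurable borel"
  by (rule borel_measurable_continuous_onI[OF continuous_on_sech])

lemma borel_measurable_poly [measurable]: "poly (p :: real poly) \<in> borel_measurable borel"
  by (intro borel_measurable_continuous_onI continuous_intros)

lemma integrable_sech_squared: "integrable lborel (\<lambda>x. sech x ^ 2)"
proof -
  have "set_integrable lborel (einterval (-\<infinity>) \<infinity>) (\<lambda>x. sech x ^ 2)"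
  proof (rule interval_integral_FTC_nonneg(1)[where F = tanh and A = "-1" and B = 1])
    show "(tanh has_real_derivative sech x ^ 2) (at x)" for x
      by (auto intro!: derivative_eq_intros simp: tanh_squared_sech)
    show "isCont (\<lambda>x. sech x ^ 2) x" for x
      using continuous_on_sech by (auto intro!: continuous_intros simp: continuous_on_eq_continuous_at)
  qed (simp_all add: ereal_tendsto_simps tanh_real_at_top tanh_real_at_bot)
  then show ?thesis
    by (simp add: set_integrable_def)
qed

text \<open>The cofactor of \<open>sech x ^ 2\<close> is bounded because \<open>sech\<close> takes
  values in [0, 1], so a multiple of \<open>sech x ^ 2\<close>, the derivative of
  \<open>tanh\<close>, dominates.\<close>

lemma integrable_poly_sech:
  assumes "[:0, 0, 1:] dvd p"
  shows "integrable lborel (\<lambda>x. c * complex_of_real (poly p (sech x)))"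
proof -
  obtain r where p: "p = [:0, 0, 1:] * r"
    using assms by (elim dvdE)
  have "compact (poly r ` {0..1})"
    by (intro compact_continuous_image continuous_intros) auto
  then obtain C where C: "\<And>y. y \<in> {0..1} \<Longrightarrow> \<bar>poly r y\<bar> \<le> C"
    by (metis bounded_iff compact_imp_bounded imageI real_norm_def)
  have "integrable lborel (\<lambda>x. poly p (sech x))"
  proof (rule Bochner_Integration.integrable_bound)
    show "integrable lborel (\<lambda>x. C * sech x ^ 2)"
      using integrable_sech_squared by simp
    have "\<bar>poly r (sech x)\<bar> * sech x ^ 2 \<le> \<bar>C\<bar> * sech x ^ 2" for x
      using C[of "sech x"] by (intro mult_right_mono) (auto simp: sech_nonneg sech_le_1)
    then show "AE x in lborel. norm (poly p (sech x)) \<le> norm (C * sech x ^ 2)"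
      by (intro AE_I2) (simp add: p abs_mult sech_nonneg power2_eq_square mult_ac)
  qed measurable
  then show ?thesis
    by simp
qed

text \<open>Two integrations by parts packed into one antiderivative: the terms in
  \<open>g' x\<close> cancel.\<close>

lemma has_vector_derivative_exp_mult:
  assumes "(g has_real_derivative g' x) (at x)" "(g' has_real_derivative g'') (at x)"
  shows "((\<lambda>x. exp (- (\<i> * complex_of_real x * complex_of_real \<xi>)) *
      (c * (complex_of_real (g' x) + \<i> * complex_of_real \<xi> * complex_of_real (g x))))
    has_vector_derivative exp (- (\<i> * complex_of_real x * complex_of_real \<xi>)) *
      (c * complex_of_real (g'' + \<xi>\<^sup>2 * g x))) (at x)"
proof -
  let ?e = "\<lambda>x::real. exp (- (\<i> * complex_of_real x * complex_of_real \<xi>))"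
  have "(?e has_vector_derivative - \<i> * complex_of_real \<xi> * ?e x) (at x)"
    by (auto intro!: derivative_eq_intros has_vector_derivative_real_field)
  from has_vector_derivative_mult[OF this has_vector_derivative_mult_right[OF
      has_vector_derivative_add[OF has_vector_derivative_of_real[OF assms(2)]
        has_vector_derivative_mult_right[OF has_vector_derivative_of_real[OF assms(1)]]]]]
  show ?thesis
    by (rule has_vector_derivative_eq_rhs) (simp add: algebra_simps power2_eq_square)
qed

lemma fourier_poly_sech_eq_0:
  assumes "poly p 0 = 0"
    and int: "[:0, 0, 1:] dvd dxx_poly p + smult (\<xi>\<^sup>2) p"
  shows "fourier (\<lambda>x. c * complex_of_real (poly (dxx_poly p + smult (\<xi>\<^sup>2) p) (sech x))) \<xi> = 0"
proof -
  let ?e = "\<lambda>x::real. exp (- (\<i> * complex_of_real x * complex_of_real \<xi>))"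
  let ?g' = "\<lambda>x. - (tanh x * sech x * poly (pderiv p) (sech x))"
  define K where "K = (\<lambda>x. c * (complex_of_real (?g' x) +
    \<i> * complex_of_real \<xi> * complex_of_real (poly p (sech x))))"
  define H where "H = (\<lambda>x. ?e x * K x)"
  define f where
    "f = (\<lambda>x. ?e x * (c * complex_of_real (poly (dxx_poly p + smult (\<xi>\<^sup>2) p) (sech x))))"
  \<comment> \<open>One argument for both ends of the line: \<open>tanh\<close> has different limits
    there, but each is multiplied by the limit 0 of \<open>sech\<close>.\<close>
  have lim: "(H \<longlongrightarrow> 0) F" if s: "(sech \<longlongrightarrow> 0) F" and t: "(tanh \<longlongrightarrow> l) F"
    for F :: "real filter" and l
  proof -
    have "(K \<longlongrightarrow> c * (complex_of_real (- (l * 0 * poly (pderiv p) 0)) +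
        \<i> * complex_of_real \<xi> * complex_of_real (poly p 0))) F"
      unfolding K_def by (intro tendsto_intros s t)
    then have "(K \<longlongrightarrow> 0) F"
      using assms(1) by simp
    moreover have "norm (H x) = norm (K x)" for x
      by (simp add: H_def norm_mult)
    ultimately show ?thesis
      by (metis (no_types, lifting) ext tendsto_norm_zero_iff)
  qed
  have "integrable lborel f"
  proof (rule Bochner_Integration.integrable_bound[OF integrable_poly_sech[OF int, of c]])
    show "f \<in> borel_measurable lborel"
      unfolding f_def by measurable
  qed (simp add: f_def norm_mult)
  have "(LBINT x=-\<infinity>..\<infinity>. f x) = 0 - 0"
  proof (rule interval_integral_FTC_integrable)
    show "(H has_vector_derivative f x) (at x)" for x
      unfolding H_def K_def f_def poly_add poly_smult
      by (rule has_vector_derivative_exp_mult has_real_derivative_dx_poly_sech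
          has_real_derivative_poly_sech)+
    show "isCont f x" for x
      unfolding f_def using continuous_on_sech
      by (auto intro!: continuous_intros simp: continuous_on_eq_continuous_at)
    show "set_integrable lborel (einterval (-\<infinity>) \<infinity>) f"
      using \<open>integrable lborel f\<close> by (simp add: set_integrable_def)
  qed (simp_all add: ereal_tendsto_simps lim[OF tendsto_sech_at_top tanh_real_at_top]
        lim[OF tendsto_sech_at_bot tanh_real_at_bot])
  then show ?thesis
    by (simp add: fourier_def f_def interval_lebesgue_integral_def set_lebesgue_integral_def)
qed

section \<open>The functions \<open>G 3 1\<close> and \<open>G 1 2\<close>\<close>

lemma Psi_sech:
  "Psi x = vector [complex_of_real (1 - sech x ^ 2), complex_of_real (- (sech x ^ 2))]"
  by (simp only: Psi_def tanh_squared_sech)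

definition G_poly :: "real poly" where
  "G_poly = smult 120 [:0, 0, 0, -2, 0, 31, 0, -83, 0, 56:]"

lemma G_3_1_eq: "G 3 1 = (\<lambda>x. - \<i> / sqrt 2 * complex_of_real (poly G_poly (sech x)))"
proof
  fix x
  \<comment> \<open>Divided by sqrt 2, the components of \<open>quad 3 Psi\<close> have sum -s + 2
    s^3 and difference -s + 6 s^3 - 6 s^5, where s = \<open>sech x\<close>.\<close>
  have "D_tilde (quad 3 Psi) x $ 1 = - \<i> / sqrt 2 * complex_of_real (poly
     (SS_poly [:0, -1, 0, 6, 0, -6:] - dxx_poly (SS_poly [:0, -1, 0, 6, 0, -6:]) +
      SS_poly ([:0, -1, 0, 2:] - dxx_poly [:0, -1, 0, 2:] - [:0, 0, 6:] * [:0, -1, 0, 2:])) (sech x))"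
    by (rule D_tilde_poly_sech)
      (simp_all add: quad_def quad3_def Psi_sech Q_def Let_def algebra_simps
        power2_eq_square)
  then show "G 3 1 x = - \<i> / sqrt 2 * complex_of_real (poly G_poly (sech x))"
    by (simp add: G_def G_poly_def SS_poly_def dxx_poly_def pderiv_pCons)
qed

text \<open>Compared with \<open>quad3\<close>, \<open>quad1\<close> has the same difference of
  components and the opposite sum. This flips the sign of \<open>A\<close>, and the second component
  carries \<open>B - A\<close>, so the same polynomial results.\<close>

lemma G_1_2_eq: "G 1 2 = (\<lambda>x. - \<i> / sqrt 2 * complex_of_real (poly G_poly (sech x)))"
proof
  fix x
  have "D_tilde (quad 1 Psi) x $ 2 = - \<i> / sqrt 2 * complex_of_real (poly
     (SS_poly [:0, -1, 0, 6, 0, -6:] - dxx_poly (SS_poly [:0, -1, 0, 6, 0, -6:]) -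
      SS_poly ([:0, 1, 0, -2:] - dxx_poly [:0, 1, 0, -2:] - [:0, 0, 6:] * [:0, 1, 0, -2:])) (sech x))"
    by (rule D_tilde_poly_sech)
      (simp_all add: quad_def quad1_def Psi_sech Q_def Let_def algebra_simps
        power2_eq_square)
  then show "G 1 2 x = - \<i> / sqrt 2 * complex_of_real (poly G_poly (sech x))"
    by (simp add: G_def G_poly_def SS_poly_def dxx_poly_def pderiv_pCons)
qed

lemma G_poly_dvd: "[:0, 0, 1:] dvd G_poly"
  by (rule dvdI[of _ _ "smult 120 [:0, -2, 0, 31, 0, -83, 0, 56:]"]) (simp add: G_poly_def)

lemma fourier_G_poly:
  assumes "\<xi>\<^sup>2 = 1"
  shows "fourier (\<lambda>x. c * complex_of_real (poly G_poly (sech x))) \<xi> = 0"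
proof -
  \<comment> \<open>As (s^n)'' + s^n = (n^2 + 1) s^n - n (n + 1) s^(n+2), matching s^3, s^5 and s^7
    determines the three coefficients; the s^9 term then agrees as well.\<close>
  define h :: "real poly" where "h = smult 120 [:0, 0, 0, -1/5, 0, 11/10, 0, -1:]"
  have "G_poly = dxx_poly h + smult (\<xi>\<^sup>2) h"
    by (simp add: assms G_poly_def h_def dxx_poly_def pderiv_pCons)
  then show ?thesis
    using fourier_poly_sech_eq_0[of h \<xi> c] G_poly_dvd by (simp add: h_def)
qed

text \<open>Integrability is asserted too, because the Bochner integral of a non-integrable function
  is 0 by convention.\<close>

theorem lemma1p6:
  shows "integrable lborel (G 3 1) \<and> integrable lborel (G 1 2) \<and>
    fourier (G 3 1) 1 = 0 \<and> fourier (G 3 1) (-1) = 0 \<and>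
    fourier (G 1 2) 1 = 0 \<and> fourier (G 1 2) (-1) = 0"
  unfolding G_3_1_eq G_1_2_eq
  by (intro conjI integrable_poly_sech G_poly_dvd fourier_G_poly) simp_all

end
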